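(* Let $X$ be a compact metric space. Then for every $m\in\mathbb{N}$ with $m\le\#X$ and every $\lambda$ with $0<\lambda\le(\operatorname{diam}X)/2$, $$2d_{GH}(\lambda\Delta_m,X)=\max\{d_m(X),\ \operatorname{diam}X-\lambda\}.$$
   Context: Here $\mathbb{N}=\{1,2,\ldots\}$, $\#X$ is the cardinality of $X$, and $d_{GH}$ is the Gromov--Hausdorff distance. For $\lambda>0$ and $m\in\mathbb{N}$, $\lambda\Delta_m$ denotes the $m$-point metric space (simplex) all of whose nonzero distances equal $\lambda$. $\mathcal{D}_m(X)$ is the family of all partitions of $X$ into $m$ nonempty subsets; for $D=\{X_1,\ldots,X_m\}\in\mathcal{D}_m(X)$ put $\operatorname{diam}D=\max_i\operatorname{diam}X_i$. Put $d_m(X)=\inf\{\operatorname{diam}D:D\in\mathcal{D}_m(X)\}$ if $\mathcal{D}_m(X)\ne\emptyset$, and $d_m(X)=\infty$ otherwise. *)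

theory Defs
  imports "HOL-Analysis.Analysis" "HOL-Library.Disjoint_Sets"
begin

text \<open>
  Metric spaces are elements of the library type \<open>'a metric\<close>, i.e. a carrier set together with a
  metric on it. Diameters and distances take values in \<open>ereal\<close>, so that the infima and suprema
  below have their usual meaning (in particular the infimum of the empty set is \<open>\<infinity>\<close>).
\<close>

definition mdiam :: "'a metric \<Rightarrow> 'a set \<Rightarrow> ereal" where
  "mdiam X A = (if A = {} then 0 else SUP (x, y) \<in> A \<times> A. ereal (mdist X x y))"

definition hausdorff_dist :: "'a metric \<Rightarrow> 'a set \<Rightarrow> 'a set \<Rightarrow> ereal" where
  "hausdorff_dist Z A B =
     Inf {ereal r | r. r > 0 \<and> A \<subseteq> (\<Union>b\<in>B. mball_of Z b r) \<and> B \<subseteq> (\<Union>a\<in>A. mball_of Z a r)}"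

definition isometric_embedding :: "'a metric \<Rightarrow> 'b metric \<Rightarrow> ('a \<Rightarrow> 'b) \<Rightarrow> bool" where
  "isometric_embedding X Z f \<longleftrightarrow>
     f \<in> mspace X \<rightarrow> mspace Z \<and>
     (\<forall>x\<in>mspace X. \<forall>y\<in>mspace X. mdist Z (f x) (f y) = mdist X x y)"

text \<open>
  The Gromov--Hausdorff distance is the infimum of the Hausdorff distances between isometric copies
  of \<open>X\<close> and \<open>Y\<close> in a common metric space \<open>Z\<close>. Only the union of the two copies matters, and it
  injects into \<open>'a + 'b\<close>; hence letting \<open>Z\<close> range over all metric spaces whose carrier is a subset
  of that type (with any metric) gives the same infimum as letting it range over all metric spaces.
\<close>

definition gh_dist :: "'a metric \<Rightarrow> 'b metric \<Rightarrow> ereal" where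
  "gh_dist X Y =
     Inf {hausdorff_dist Z (f ` mspace X) (g ` mspace Y) | (Z :: ('a + 'b) metric) f g.
            isometric_embedding X Z f \<and> isometric_embedding Y Z g}"

text \<open>
  The space $\lambda\Delta_m$, on the points \<open>0, \<dots>, m - 1\<close>. It is meaningful only for \<open>l > 0\<close>:
  otherwise the pair need not be a metric space and \<open>metric\<close> is unspecified on it.
\<close>

definition simplex_space :: "real \<Rightarrow> nat \<Rightarrow> nat metric" where
  "simplex_space l m = metric ({..<m}, \<lambda>i j. if i = j then 0 else l)"

lemma Metric_space_simplex:
  assumes "l > 0"
  shows "Metric_space {..<m} (\<lambda>i j. if i = j then 0 else l)"
  using assms by unfold_locales auto

lemma mspace_simplex_space [simp]: "l > 0 \<Longrightarrow> mspace (simplex_space l m) = {..<m}"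
  unfolding simplex_space_def by (rule Metric_space.mspace_metric [OF Metric_space_simplex])

lemma mdist_simplex_space [simp]:
  "l > 0 \<Longrightarrow> mdist (simplex_space l m) i j = (if i = j then 0 else l)"
  unfolding simplex_space_def by (simp add: Metric_space.mdist_metric [OF Metric_space_simplex])

definition partitions_into :: "nat \<Rightarrow> 'a set \<Rightarrow> 'a set set set" where
  "partitions_into m A = {D. partition_on A D \<and> finite D \<and> card D = m}"

definition partition_diam :: "'a metric \<Rightarrow> 'a set set \<Rightarrow> ereal" where
  "partition_diam X D = (SUP A\<in>D. mdiam X A)"

text \<open>If there is no partition into \<open>m\<close> parts, this infimum is \<open>\<infinity>\<close>.\<close>

definition partition_inf_diam :: "nat \<Rightarrow> 'a metric \<Rightarrow> ereal" where
  "partition_inf_diam m X = (INF D \<in> partitions_into m (mspace X). partition_diam X D)"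

end

theory Submission
  imports Defs
begin

text \<open>
  Write $d$ for the diameter of $X$, which compactness makes finite.

  Lower bound: suppose that $\lambda\Delta_m$ and $X$ sit isometrically in a common space, with $X$
  inside the $r$-neighbourhood of the simplex. Send each point of $X$ to a vertex at distance less
  than $r$. By the triangle inequality two points with the same vertex are at distance at most
  $2r$, and any two points are at distance at most $2r + \lambda$, so $d - \lambda \le 2r$. The
  fibres of the vertex map partition $X$ into at most $m$ parts of diameter at most $2r$. Some
  vertices may not be used, but as $X$ has at least $m$ points, parts can be split until there are
  exactly $m$ of them, and splitting does not increase diameters; hence $d_m(X) \le 2r$. This is
  \<open>hausdorff_neighbourhood_bounds\<close>, resting on \<open>partition_refine_to_card\<close>.

  Upper bound: let $D = \{X_0, \dots, X_{m-1}\}$ be a partition and $e = \max(\mathrm{diam}\, D,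
  d - \lambda)$. Put the $i$-th vertex at distance
  $e/2 + \min(\lambda, \mathrm{dist}(x, X_i))$ from $x \in X$. The assumption
  $\lambda \le d/2$ gives $\lambda \le d - \lambda \le e$, and with it this is a metric on the
  disjoint union of the two spaces. Each vertex is at distance $e/2$ from the points of its part,
  so the Hausdorff distance is at most $e/2$. This is \<open>gh_dist_simplex_le\<close>; the infimum over all
  $D$ then gives the claim.
\<close>

section \<open>Diameters\<close>

lemma mdiam_upper: "x \<in> A \<Longrightarrow> y \<in> A \<Longrightarrow> ereal (mdist X x y) \<le> mdiam X A"
  unfolding mdiam_def by (auto intro!: SUP_upper2[of "(x, y)"])

lemma mdiam_le_iff:
  "A \<noteq> {} \<Longrightarrow> mdiam X A \<le> c \<longleftrightarrow> (\<forall>x\<in>A. \<forall>y\<in>A. ereal (mdist X x y) \<le> c)"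
  unfolding mdiam_def by (auto simp: SUP_le_iff)

lemma mdiam_nonneg: "0 \<le> mdiam X A"
proof (cases "A = {}")
  case False
  then obtain x where x: "x \<in> A" by auto
  have "0 \<le> ereal (mdist X x x)" by simp
  also have "\<dots> \<le> mdiam X A" by (rule mdiam_upper[OF x x])
  finally show ?thesis .
qed (simp add: mdiam_def)

lemma mdiam_mono:
  assumes "A \<subseteq> B" shows "mdiam X A \<le> mdiam X B"
proof (cases "A = {}")
  case True
  then show ?thesis using mdiam_nonneg[of X B] by (simp add: mdiam_def)
next
  case False
  then show ?thesis using assms by (auto simp: mdiam_le_iff intro: mdiam_upper)
qed

lemma mdiam_compact_finite:
  assumes "compact_space (mtopology_of X)"
  obtains d where "mdiam X (mspace X) = ereal d"
proof -
  interpret Metric_space "mspace X" "mdist X" by simp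
  have "mbounded (mspace X)"
    using assms by (intro compactin_imp_mbounded) (simp add: mtopology_of_def compact_space_def)
  then obtain B where B: "\<forall>x\<in>mspace X. \<forall>y\<in>mspace X. mdist X x y \<le> B"
    unfolding mbounded_alt by auto
  define C where "C = max B 0"
  have C: "0 \<le> C" "B \<le> C" by (simp_all add: C_def)
  have "mdiam X (mspace X) \<le> ereal C"
  proof (cases "mspace X = {}")
    case True
    then show ?thesis using C by (simp add: mdiam_def)
  next
    case False
    then show ?thesis using B C by (auto simp: mdiam_le_iff intro: order_trans)
  qed
  with mdiam_nonneg[of X "mspace X"] that show ?thesis
    by (cases "mdiam X (mspace X)") auto
qed

section \<open>Refining partitions\<close>

lemma partition_on_fibres: "partition_on A ((\<lambda>i. {x\<in>A. h x = i}) ` h ` A)"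
  by (rule partition_onI) (auto simp: disjnt_iff)

text \<open>
  A partition with fewer parts than points has a part with two points; one of them is split off.
\<close>
lemma partition_refine_by_one:
  assumes P: "partition_on A P" "finite P" and small: "infinite A \<or> card P < card A"
  obtains Q where "refines A Q P" "finite Q" "card Q = Suc (card P)"
proof -
  \<comment> \<open>If all parts were singletons, there would be as many parts as points.\<close>
  have "\<exists>B\<in>P. \<exists>x\<in>B. B \<noteq> {x}"
  proof (rule ccontr)
    assume "\<not> ?thesis"
    then have single: "B = {x}" if "B \<in> P" "x \<in> B" for B x using that by auto
    have sing: "card B = 1 \<and> finite B" if "B \<in> P" for B
    proof -
      have "B \<noteq> {}" using that partition_onD3[OF P(1)] by blast
      then obtain x where "x \<in> B" by blast
      with single[OF that] have "B = {x}" by simp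
      then show ?thesis by simp
    qed
    have "finite A"
      unfolding partition_onD1[OF P(1)] using P(2) sing by (intro finite_Union) auto
    moreover have "card A = sum card P"
      unfolding partition_onD1[OF P(1)]
      using sing by (intro card_Union_disjoint partition_onD2[OF P(1)]) auto
    then have "card A = card P" using sing by simp
    ultimately show False using small by simp
  qed
  then obtain B x where B: "B \<in> P" "x \<in> B" "B \<noteq> {x}" by auto
  define Q where "Q = insert {x} (insert (B - {x}) (P - {B}))"
  have disj: "\<And>C D. C \<in> P \<Longrightarrow> D \<in> P \<Longrightarrow> C \<noteq> D \<Longrightarrow> C \<inter> D = {}"
    using P(1) by (auto simp: partition_on_def disjoint_def)
  have ne: "{} \<notin> P" "\<Union>P = A" using P(1) by (auto simp: partition_on_def)
  have "partition_on A Q"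
  proof (rule partition_onI)
    show "\<Union>Q = A" using ne B by (auto simp: Q_def)
    show "{} \<notin> Q" using ne B by (auto simp: Q_def)
    show "disjnt p q" if "p \<in> Q" "q \<in> Q" "p \<noteq> q" for p q
      using that B disj unfolding Q_def disjnt_def by blast
  qed
  moreover have "\<forall>C\<in>Q. \<exists>D\<in>P. C \<subseteq> D" using B by (auto simp: Q_def)
  ultimately have "refines A Q P" using P(1) by (simp add: refines_def)
  moreover have "finite Q" using P by (simp add: Q_def)
  moreover have "card Q = Suc (card P)"
  proof -
    have "B - {x} \<notin> P - {B}" using disj[of B "B - {x}"] ne B by blast
    moreover have "{x} \<notin> insert (B - {x}) (P - {B})" using disj[of B "{x}"] B by blast
    moreover have "card P > 0" using B P(2) by (auto simp: card_gt_0_iff)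
    ultimately show ?thesis using P(2) B(1) by (simp add: Q_def card_Diff_singleton)
  qed
  ultimately show thesis by (rule that)
qed

lemma partition_refine_to_card:
  assumes "partition_on A P" "finite P" "card P \<le> m" "infinite A \<or> m \<le> card A"
  obtains Q where "refines A Q P" "Q \<in> partitions_into m A"
proof -
  have "\<exists>Q. refines A Q P \<and> finite Q \<and> card Q = m"
    using assms(3,4)
  proof (induction m rule: dec_induct)
    case base
    then show ?case using assms by (auto intro: refines_refl)
  next
    case (step n)
    then obtain Q where Q: "refines A Q P" "finite Q" "card Q = n" by auto
    have "partition_on A Q" using Q(1) by (simp add: refines_def)
    moreover have "infinite A \<or> card Q < card A" using step.prems Q(3) by auto
    ultimately obtain R where R: "refines A R Q" "finite R" "card R = Suc n"
      using Q(2,3) by (metis partition_refine_by_one)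
    have "refines A R P" by (rule refines_trans[OF R(1) Q(1)])
    with R show ?case by blast
  qed
  with that show thesis by (auto simp: partitions_into_def refines_def)
qed

lemma partition_diam_refines_le:
  assumes "refines A Q P" shows "partition_diam X Q \<le> partition_diam X P"
  unfolding partition_diam_def
proof (rule SUP_mono)
  fix B assume "B \<in> Q"
  with assms obtain C where "C \<in> P" "B \<subseteq> C" by (auto simp: refines_def)
  then show "\<exists>C\<in>P. mdiam X B \<le> mdiam X C" by (auto intro: mdiam_mono)
qed

text \<open>
  The map \<open>h\<close> may miss some values, so its fibres can be fewer than \<open>m\<close>; the partition that
  bounds the infimum is a refinement of them.
\<close>
lemma partition_inf_diam_le_fibres:
  assumes h: "h \<in> mspace X \<rightarrow> {..<m}"
    and m: "infinite (mspace X) \<or> m \<le> card (mspace X)"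
    and le: "\<And>x y. x \<in> mspace X \<Longrightarrow> y \<in> mspace X \<Longrightarrow> h x = h y \<Longrightarrow> ereal (mdist X x y) \<le> c"
  shows "partition_inf_diam m X \<le> c"
proof -
  define P where "P = (\<lambda>i. {x\<in>mspace X. h x = i}) ` h ` mspace X"
  have sub: "h ` mspace X \<subseteq> {..<m}" using h by auto
  then have fin: "finite (h ` mspace X)" by (rule finite_subset) simp
  have "card P \<le> card (h ` mspace X)" unfolding P_def by (rule card_image_le[OF fin])
  also have "\<dots> \<le> m" using card_mono[OF _ sub] by simp
  finally have "card P \<le> m" .
  moreover have "partition_on (mspace X) P" unfolding P_def by (rule partition_on_fibres)
  moreover have "finite P" using fin by (simp add: P_def)
  ultimately obtain Q where Q: "refines (mspace X) Q P" "Q \<in> partitions_into m (mspace X)"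
    using m partition_refine_to_card by blast
  have "partition_inf_diam m X \<le> partition_diam X Q"
    unfolding partition_inf_diam_def by (rule INF_lower[OF Q(2)])
  also have "\<dots> \<le> partition_diam X P" by (rule partition_diam_refines_le[OF Q(1)])
  also have "\<dots> \<le> c"
    unfolding partition_diam_def
  proof (rule SUP_least)
    fix B assume "B \<in> P"
    then have "B \<noteq> {}" and "\<And>x y. x \<in> B \<Longrightarrow> y \<in> B \<Longrightarrow> ereal (mdist X x y) \<le> c"
      using le by (auto simp: P_def)
    then show "mdiam X B \<le> c" by (simp add: mdiam_le_iff)
  qed
  finally show ?thesis .
qed

section \<open>Gluing two metric spaces\<close>

text \<open>
  The absolute values make the function nonnegative everywhere, also off the carriers, as the
  locale of metric spaces demands; on the carriers \<open>c\<close> will be positive.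
\<close>
fun glue_dist :: "'a metric \<Rightarrow> 'b metric \<Rightarrow> ('a \<Rightarrow> 'b \<Rightarrow> real) \<Rightarrow> 'a + 'b \<Rightarrow> 'a + 'b \<Rightarrow> real" where
  "glue_dist X Y c (Inl x) (Inl x') = mdist X x x'"
| "glue_dist X Y c (Inr y) (Inr y') = mdist Y y y'"
| "glue_dist X Y c (Inl x) (Inr y) = \<bar>c x y\<bar>"
| "glue_dist X Y c (Inr y) (Inl x) = \<bar>c x y\<bar>"

text \<open>
  This bounds a Gromov--Hausdorff distance by prescribing the cross distances \<open>c\<close> alone. In a
  disjoint union the triangle inequalities that are not inherited from \<open>X\<close> or \<open>Y\<close> involve two
  points of one space and one of the other: either the two points are the ends (\<open>X1\<close>, \<open>Y1\<close>), or
  one of them is the intermediate point (\<open>X2\<close>, \<open>Y2\<close>).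
\<close>
lemma gh_dist_le_glue:
  fixes X :: "'a metric" and Y :: "'b metric"
  assumes pos: "\<And>x y. x \<in> mspace X \<Longrightarrow> y \<in> mspace Y \<Longrightarrow> 0 < c x y"
    and X1: "\<And>x x' y. x \<in> mspace X \<Longrightarrow> x' \<in> mspace X \<Longrightarrow> y \<in> mspace Y \<Longrightarrow>
               mdist X x x' \<le> c x y + c x' y"
    and X2: "\<And>x x' y. x \<in> mspace X \<Longrightarrow> x' \<in> mspace X \<Longrightarrow> y \<in> mspace Y \<Longrightarrow>
               c x y \<le> mdist X x x' + c x' y"
    and Y1: "\<And>x y y'. x \<in> mspace X \<Longrightarrow> y \<in> mspace Y \<Longrightarrow> y' \<in> mspace Y \<Longrightarrow>
               mdist Y y y' \<le> c x y + c x y'"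
    and Y2: "\<And>x y y'. x \<in> mspace X \<Longrightarrow> y \<in> mspace Y \<Longrightarrow> y' \<in> mspace Y \<Longrightarrow>
               c x y \<le> mdist Y y y' + c x y'"
    and nearX: "\<And>x. x \<in> mspace X \<Longrightarrow> \<exists>y\<in>mspace Y. c x y \<le> r"
    and nearY: "\<And>y. y \<in> mspace Y \<Longrightarrow> \<exists>x\<in>mspace X. c x y \<le> r"
    and r: "0 \<le> r"
  shows "gh_dist X Y \<le> ereal r"
proof -
  define M where "M = Inl ` mspace X \<union> Inr ` mspace Y"
  have "Metric_space M (glue_dist X Y c)"
  proof
    show "0 \<le> glue_dist X Y c u v" for u v
      by (cases u; cases v) auto
    show "glue_dist X Y c u v = glue_dist X Y c v u" for u v
      by (cases u; cases v) (auto simp: mdist_commute)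
    show "glue_dist X Y c u v = 0 \<longleftrightarrow> u = v" if "u \<in> M" "v \<in> M" for u v
      using that pos by (force simp: M_def)
    show "glue_dist X Y c u w \<le> glue_dist X Y c u v + glue_dist X Y c v w"
      if "u \<in> M" "v \<in> M" "w \<in> M" for u v w
    proof -
      have abs_c: "\<And>x y. x \<in> mspace X \<Longrightarrow> y \<in> mspace Y \<Longrightarrow> \<bar>c x y\<bar> = c x y"
        using pos by (simp add: less_imp_le)
      have Y2': "c x y \<le> c x y' + mdist Y y' y"
        if "x \<in> mspace X" "y \<in> mspace Y" "y' \<in> mspace Y" for x y y'
        using Y2[OF that] by (simp add: mdist_commute)
      have X2': "c x y \<le> c x' y + mdist X x' x"
        if "x \<in> mspace X" "x' \<in> mspace X" "y \<in> mspace Y" for x x' y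
        using X2[OF that] by (simp add: mdist_commute)
      show ?thesis
        using that unfolding M_def
        by (auto simp: abs_c intro: X1 X2 Y1 Y2 X2' Y2' mdist_triangle)
    qed
  qed
  then interpret G: Metric_space M "glue_dist X Y c" .
  define Z where "Z = metric (M, glue_dist X Y c)"
  have Z: "mspace Z = M" "mdist Z = glue_dist X Y c"
    by (simp_all add: Z_def)
  have emb: "isometric_embedding X Z Inl" "isometric_embedding Y Z Inr"
    by (auto simp: isometric_embedding_def Z M_def)
  \<comment> \<open>The balls are open, so only radii strictly above \<open>r\<close> are sure to work.\<close>
  have "hausdorff_dist Z (Inl ` mspace X) (Inr ` mspace Y) \<le> ereal s" if "r < s" for s
    unfolding hausdorff_dist_def
  proof (rule Inf_lower, safe intro!: exI[of _ s])
    show "0 < s" using r that by simp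
    show "Inl x \<in> (\<Union>b\<in>Inr ` mspace Y. mball_of Z b s)" if x: "x \<in> mspace X" for x
      using nearX[OF x] x \<open>r < s\<close> pos by (force simp: Z M_def)
    show "Inr y \<in> (\<Union>a\<in>Inl ` mspace X. mball_of Z a s)" if y: "y \<in> mspace Y" for y
      using nearY[OF y] y \<open>r < s\<close> pos by (force simp: Z M_def)
  qed
  then have "hausdorff_dist Z (Inl ` mspace X) (Inr ` mspace Y) \<le> ereal r"
    by - (rule ereal_le_epsilon2, simp)
  moreover have "gh_dist X Y \<le> hausdorff_dist Z (Inl ` mspace X) (Inr ` mspace Y)"
    unfolding gh_dist_def using emb by (intro Inf_lower) blast
  ultimately show ?thesis by (rule order_trans[rotated])
qed

section \<open>Distance to a set\<close>

definition mdist_set :: "'a metric \<Rightarrow> 'a \<Rightarrow> 'a set \<Rightarrow> real" where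
  "mdist_set X x A = (INF a\<in>A. mdist X x a)"

lemma mdist_set_bdd_below: "bdd_below (mdist X x ` A)"
  by (rule bdd_belowI2[of _ 0]) simp

lemma mdist_set_le: "a \<in> A \<Longrightarrow> mdist_set X x A \<le> mdist X x a"
  unfolding mdist_set_def by (rule cINF_lower[OF mdist_set_bdd_below])

lemma mdist_set_greatest:
  "A \<noteq> {} \<Longrightarrow> (\<And>a. a \<in> A \<Longrightarrow> r \<le> mdist X x a) \<Longrightarrow> r \<le> mdist_set X x A"
  unfolding mdist_set_def by (rule cINF_greatest)

lemma mdist_set_nonneg: "A \<noteq> {} \<Longrightarrow> 0 \<le> mdist_set X x A"
  by (rule mdist_set_greatest) auto

lemma mdist_set_eq_0:
  assumes "x \<in> A" "A \<subseteq> mspace X" shows "mdist_set X x A = 0"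
proof -
  have "mdist_set X x A \<le> mdist X x x" by (rule mdist_set_le[OF assms(1)])
  also have "\<dots> = 0" using assms by auto
  finally show ?thesis using mdist_set_nonneg[of A X x] assms by (auto intro: antisym)
qed

lemma mdist_set_triangle:
  assumes "x \<in> mspace X" "y \<in> mspace X" "A \<subseteq> mspace X" "A \<noteq> {}"
  shows "mdist_set X x A \<le> mdist X x y + mdist_set X y A"
proof -
  have "mdist_set X x A - mdist X x y \<le> mdist X y a" if a: "a \<in> A" for a
    using mdist_set_le[OF a, of X x] mdist_triangle[of x X y a] assms a by (auto simp: subset_iff)
  then have "mdist_set X x A - mdist X x y \<le> mdist_set X y A"
    by (rule mdist_set_greatest[OF assms(4)])
  then show ?thesis by simp
qed

text \<open>
  A path from \<open>x\<close> to \<open>y\<close> by way of \<open>A\<close>: distances to \<open>A\<close> need not be attained, so the endpoints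
  \<open>a\<close> and \<open>b\<close> of the step inside \<open>A\<close> vary and the infima are taken one after the other.
\<close>
lemma mdist_le_through_set:
  assumes "x \<in> mspace X" "y \<in> mspace X" "A \<subseteq> mspace X" "A \<noteq> {}"
    and e: "\<And>a b. a \<in> A \<Longrightarrow> b \<in> A \<Longrightarrow> mdist X a b \<le> e"
  shows "mdist X x y \<le> mdist_set X x A + e + mdist_set X y A"
proof -
  have "mdist X x y - e - mdist X y b \<le> mdist X x a" if a: "a \<in> A" and b: "b \<in> A" for a b
    using mdist_triangle[of x X a y] mdist_triangle[of a X b y] e[OF a b] a b assms(1-3)
      mdist_commute[of X b y] by (auto simp: subset_iff)
  then have "mdist X x y - e - mdist X y b \<le> mdist_set X x A" if "b \<in> A" for b
    using that by (intro mdist_set_greatest[OF assms(4)])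
  then have "mdist X x y - e - mdist_set X x A \<le> mdist_set X y A"
    by (intro mdist_set_greatest[OF assms(4)]) (simp add: algebra_simps)
  then show ?thesis by simp
qed

section \<open>The two estimates\<close>

text \<open>
  The cross distance used below is the largest one for which each vertex is at distance \<open>e / 2\<close>
  from all points of its part: from vertex \<open>i\<close> a point \<open>x\<close> is reached either through a point of
  the \<open>i\<close>-th part, or through the vertex of the part of \<open>x\<close> at the extra cost \<open>l\<close>. The triangle
  inequality to be verified for two points of \<open>X\<close> and the detour through a vertex splits into two
  cases. If one of the points is at distance at least \<open>l\<close> from the part of the vertex, the detour
  has length at least \<open>e + l\<close>, which bounds the diameter of \<open>X\<close>. Otherwise the detour is at least
  as long as a path through the part, whose diameter is at most \<open>e\<close>.
\<close>
lemma gh_dist_simplex_le: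
  assumes l: "0 < l" "l \<le> e"
    and D: "D \<in> partitions_into m (mspace X)" "partition_diam X D \<le> ereal e"
    and diam: "mdiam X (mspace X) \<le> ereal (l + e)"
  shows "gh_dist (simplex_space l m) X \<le> ereal (e / 2)"
proof -
  have part: "partition_on (mspace X) D" and "finite D" "card D = m"
    using D by (auto simp: partitions_into_def)
  then obtain A where A: "bij_betw A {..<m} D"
    using finite_same_card_bij[of "{..<m}" D] by auto
  have AD: "A i \<in> D" if "i < m" for i using A that by (auto simp: bij_betw_def)
  have sub: "A i \<subseteq> mspace X" and ne: "A i \<noteq> {}" if "i < m" for i
    using AD[OF that] part by (auto simp: partition_on_def)
  have small: "mdist X a b \<le> e" if "i < m" "a \<in> A i" "b \<in> A i" for i a b
  proof -
    have "ereal (mdist X a b) \<le> mdiam X (A i)" using that by (intro mdiam_upper)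
    also have "\<dots> \<le> partition_diam X D"
      unfolding partition_diam_def by (rule SUP_upper[OF AD[OF that(1)]])
    finally show ?thesis using D(2) by (metis ereal_less_eq(3) order_trans)
  qed
  have large: "mdist X x y \<le> l + e" if "x \<in> mspace X" "y \<in> mspace X" for x y
    using mdiam_upper[OF that, of X] diam by (metis ereal_less_eq(3) order_trans)
  define c where "c i x = e / 2 + min l (mdist_set X x (A i))" for i x
  have c: "e / 2 \<le> c i x" "c i x \<le> e / 2 + l" if "i < m" for i x
    using mdist_set_nonneg[OF ne[OF that], of X x] l by (auto simp: c_def)
  have c_in: "c i x = e / 2" if "i < m" "x \<in> A i" for i x
    using mdist_set_eq_0[of x "A i" X] sub that l by (simp add: c_def)
  show ?thesis
  proof (rule gh_dist_le_glue[where c = c], unfold mspace_simplex_space[OF l(1)] lessThan_iff)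
    show "0 < c i x" if "i < m" for i x using c[OF that, of x] l by simp
    show "mdist (simplex_space l m) i j \<le> c i x + c j x" if "i < m" "j < m" for i j x
      using c[OF that(1), of x] c[OF that(2), of x] l by auto
    show "c i x \<le> mdist (simplex_space l m) i j + c j x" if "i < m" "j < m" for i j x
      using c[OF that(1), of x] c[OF that(2), of x] l by auto
    show "mdist X x y \<le> c i x + c i y" if "i < m" "x \<in> mspace X" "y \<in> mspace X" for i x y
      using mdist_le_through_set[OF that(2,3) sub[OF that(1)] ne[OF that(1)] small[OF that(1)]]
        large[OF that(2,3)] mdist_set_nonneg[OF ne[OF that(1)], of X x]
        mdist_set_nonneg[OF ne[OF that(1)], of X y] l
      by (auto simp: c_def min_def)
    show "c i x \<le> mdist X x y + c i y" if "i < m" "x \<in> mspace X" "y \<in> mspace X" for i x y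
      using mdist_set_triangle[OF that(2,3) sub[OF that(1)] ne[OF that(1)]] mdist_nonneg[of X x y]
      unfolding c_def by linarith
    show "\<exists>x\<in>mspace X. c i x \<le> e / 2" if "i < m" for i
      using ne[OF that] sub[OF that] c_in[OF that] by fastforce
    show "\<exists>i\<in>{..<m}. c i x \<le> e / 2" if x: "x \<in> mspace X" for x
    proof -
      from x part obtain B where "B \<in> D" "x \<in> B" by (auto simp: partition_on_def)
      then obtain i where "i < m" "x \<in> A i" using A by (auto simp: bij_betw_def)
      then show ?thesis using c_in by (intro bexI[of _ i]) auto
    qed
    show "0 \<le> e / 2" using l by simp
  qed
qed

text \<open>
  Neighbourhoods of different vertices may overlap when \<open>l < 2 * r\<close>, so they do not themselves form a
  partition; choosing one vertex \<open>h x\<close> near each point \<open>x\<close> repairs this, at the price that \<open>h\<close>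
  need not be surjective.
\<close>
lemma hausdorff_neighbourhood_bounds:
  assumes l: "0 < l" "0 < r"
    and f: "isometric_embedding (simplex_space l m) Z f" and g: "isometric_embedding X Z g"
    and cov: "g ` mspace X \<subseteq> (\<Union>b\<in>f ` mspace (simplex_space l m). mball_of Z b r)"
    and m: "infinite (mspace X) \<or> m \<le> card (mspace X)"
  shows "partition_inf_diam m X \<le> ereal (2 * r)" and "mdiam X (mspace X) \<le> ereal (2 * r + l)"
proof -
  have "\<forall>x\<in>mspace X. \<exists>i<m. mdist Z (f i) (g x) < r"
    using cov l by fastforce
  then obtain h where h: "\<And>x. x \<in> mspace X \<Longrightarrow> h x < m \<and> mdist Z (f (h x)) (g x) < r"
    by metis
  have bound: "mdist X x y \<le> 2 * r + (if h x = h y then 0 else l)"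
    if x: "x \<in> mspace X" and y: "y \<in> mspace X" for x y
  proof -
    have in_Z: "f (h x) \<in> mspace Z" "f (h y) \<in> mspace Z" "g x \<in> mspace Z" "g y \<in> mspace Z"
      using f g h[OF x] h[OF y] x y l by (auto simp: isometric_embedding_def)
    have "mdist X x y = mdist Z (g x) (g y)"
      using g x y by (simp add: isometric_embedding_def)
    also have "\<dots> \<le> mdist Z (g x) (f (h x)) + mdist Z (f (h x)) (f (h y)) + mdist Z (f (h y)) (g y)"
      using mdist_triangle[OF in_Z(3,1,4)] mdist_triangle[OF in_Z(1,2,4)] by simp
    also have "mdist Z (f (h x)) (f (h y)) = (if h x = h y then 0 else l)"
      using f h[OF x] h[OF y] l by (simp add: isometric_embedding_def)
    finally show ?thesis using h[OF x] h[OF y] by (simp add: mdist_commute)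
  qed
  show "partition_inf_diam m X \<le> ereal (2 * r)"
  proof (rule partition_inf_diam_le_fibres[OF _ m])
    show "h \<in> mspace X \<rightarrow> {..<m}" using h by auto
    show "ereal (mdist X x y) \<le> ereal (2 * r)"
      if "x \<in> mspace X" "y \<in> mspace X" "h x = h y" for x y
      using bound[OF that(1,2)] that(3) by simp
  qed
  show "mdiam X (mspace X) \<le> ereal (2 * r + l)"
  proof (cases "mspace X = {}")
    case True
    then show ?thesis using l by (simp add: mdiam_def)
  next
    case False
    have "mdist X x y \<le> 2 * r + l" if "x \<in> mspace X" "y \<in> mspace X" for x y
      using bound[OF that] l by (simp split: if_splits)
    with False show ?thesis by (simp add: mdiam_le_iff)
  qed
qed

theorem theorem4p15:
  fixes X :: "'a metric" and m :: nat and l :: real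
  assumes "compact_space (mtopology_of X)"
    and "m \<ge> 1"
    and "infinite (mspace X) \<or> m \<le> card (mspace X)"
    and "0 < l" and "ereal l \<le> mdiam X (mspace X) / 2"
  shows "2 * gh_dist (simplex_space l m) X =
         max (partition_inf_diam m X) (mdiam X (mspace X) - ereal l)"
proof (rule antisym)
  obtain d where d: "mdiam X (mspace X) = ereal d"
    using mdiam_compact_finite[OF assms(1)] .
  have "2 * l \<le> d" using assms(5) by (simp add: d)
  let ?G = "2 * gh_dist (simplex_space l m) X"
  have upper: "?G \<le> max (partition_diam X D) (ereal (d - l))"
    if D: "D \<in> partitions_into m (mspace X)" for D
  proof (cases "max (partition_diam X D) (ereal (d - l))")
    case (real e)
    then have "partition_diam X D \<le> ereal e" "ereal (d - l) \<le> ereal e"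
      by (metis max.cobounded1, metis max.cobounded2)
    then have "gh_dist (simplex_space l m) X \<le> ereal (e / 2)"
      using \<open>2 * l \<le> d\<close> assms(4) D by (intro gh_dist_simplex_le) (auto simp: d)
    then have "?G \<le> 2 * ereal (e / 2)" by (intro ereal_mult_left_mono) auto
    then show ?thesis by (simp add: real)
  next
    case PInf
    then show ?thesis by simp
  next
    case MInf
    then show ?thesis by (metis max.cobounded2 MInfty_neq_ereal(2) ereal_infty_less_eq(2))
  qed
  show "?G \<le> max (partition_inf_diam m X) (mdiam X (mspace X) - ereal l)"
  \<comment> \<open>The term \<open>d - l\<close> does not depend on the partition: if it is not an upper bound by itself,
    every partition diameter is one, and so is their infimum.\<close>
  proof (cases "?G \<le> ereal (d - l)")
    case True
    then show ?thesis by (simp add: d le_max_iff_disj)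
  next
    case False
    with upper have "?G \<le> partition_inf_diam m X"
      unfolding partition_inf_diam_def by (intro INF_greatest) (auto simp: le_max_iff_disj)
    then show ?thesis by (simp add: le_max_iff_disj)
  qed
  let ?M = "max (partition_inf_diam m X) (mdiam X (mspace X) - ereal l)"
  have "?M / 2 \<le> gh_dist (simplex_space l m) X"
    unfolding gh_dist_def hausdorff_dist_def
  proof (intro Inf_greatest, clarify, intro Inf_greatest, clarify)
    fix Z :: "(nat + 'a) metric" and f g r
    assume f: "isometric_embedding (simplex_space l m) Z f" and g: "isometric_embedding X Z g"
      and r: "0 < r"
      and cov: "g ` mspace X \<subseteq> (\<Union>b\<in>f ` mspace (simplex_space l m). mball_of Z b r)"
    have "?M \<le> 2 * ereal r"
      using hausdorff_neighbourhood_bounds[OF assms(4) r f g cov assms(3)] by (simp add: d)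
    then show "?M / 2 \<le> ereal r" by (simp add: ereal_divide_le_pos)
  qed
  then show "?M \<le> ?G" by (simp add: ereal_divide_le_pos)
qed

end
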